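(* Let $\mathbb{Z}_6[Y]$ be the polynomial ring over $\mathbb{Z}_6$ in the variable $Y$ and let $\mathbf{G}=(\mathbb{Z}_6[Y];\oplus)$ be the binary groupoid with the operation $X_1\oplus X_2=3Y\cdot X_1+2Y\cdot X_2$. Then $\mathbf{G}$ has the associative spectrum given, for all $n\in\mathbb{N}$ with $n\ge2$, by $$s_n(\mathbf{G})=\frac{n^2+n-2}{2}.$$ Instead of $\mathbb{Z}_6[Y]$ another ring can be chosen which has zero divisors (in this case $3Y$ and $2Y$) whose powers are all different.
   Context: $\mathbb{Z}_6$ is the ring of integers modulo 6. The set $T$ of binary bracketings consists of the terms (prefix notation) over the single variable $x$ and the binary operation symbol $\omega$, i.e. $x\in T$, and $\omega t_1t_2\in T$ whenever $t_1,t_2\in T$. $B_n^{(2)}$ is the set of bracketings with exactly $n$ occurrences of $\omega$ (hence $n+1$ occurrences of $x$). For $t\in B_n^{(2)}$, $\varepsilon_1(t)$ is the term obtained from $t$ by replacing the occurrences of $x$, from left to right, by distinct variables $x_1,\ldots,x_{n+1}$. For a binary groupoid $\mathbf{A}$ (a set with one binary operation, interpreting $\omega$), $\sigma_n(\mathbf{A})$ is the equivalence relation on $B_n^{(2)}$ consisting of all $(s,t)$ such that $\mathbf{A}$ satisfies the identity $\varepsilon_1(s)\approx\varepsilon_1(t)$, and the associative spectrum of $\mathbf{A}$ is the sequence $s_n(\mathbf{A})=|B_n^{(2)}/\sigma_n(\mathbf{A})|$, $n\in\mathbb{N}$. *)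

theory Defs
  imports Complex_Main "HOL-Library.Numeral_Type" "HOL-Computational_Algebra.Polynomial"
begin

datatype 'v trm = Var 'v | Omega "'v trm" "'v trm"

text \<open>The single variable $x$ is \<^term>\<open>Var ()\<close>.\<close>

type_synonym bracketing = "unit trm"

primrec num_omega :: "'v trm \<Rightarrow> nat" where
  "num_omega (Var v) = 0"
| "num_omega (Omega s t) = Suc (num_omega s + num_omega t)"

definition bracketings :: "nat \<Rightarrow> bracketing set" where
  "bracketings n = {t. num_omega t = n}"

text \<open>\<^term>\<open>number_from k t\<close> replaces the variable occurrences of \<^term>\<open>t\<close>, from left to
  right, by $x_k, x_{k+1}, \ldots$; a term \<^term>\<open>s\<close> has \<^term>\<open>num_omega s + 1\<close> of them.\<close>

primrec number_from :: "nat \<Rightarrow> 'v trm \<Rightarrow> nat trm" where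
  "number_from k (Var v) = Var k"
| "number_from k (Omega s t) =
     Omega (number_from k s) (number_from (k + (num_omega s + 1)) t)"

definition eps1 :: "bracketing \<Rightarrow> nat trm" where
  "eps1 t = number_from 1 t"

text \<open>A groupoid is a binary operation on a whole type.\<close>

primrec eval_trm :: "('a \<Rightarrow> 'a \<Rightarrow> 'a) \<Rightarrow> ('v \<Rightarrow> 'a) \<Rightarrow> 'v trm \<Rightarrow> 'a" where
  "eval_trm f \<rho> (Var v) = \<rho> v"
| "eval_trm f \<rho> (Omega s t) = f (eval_trm f \<rho> s) (eval_trm f \<rho> t)"

definition satisfies_identity :: "('a \<Rightarrow> 'a \<Rightarrow> 'a) \<Rightarrow> 'v trm \<Rightarrow> 'v trm \<Rightarrow> bool" where
  "satisfies_identity f s t \<longleftrightarrow> (\<forall>\<rho>. eval_trm f \<rho> s = eval_trm f \<rho> t)"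

definition assoc_rel :: "('a \<Rightarrow> 'a \<Rightarrow> 'a) \<Rightarrow> nat \<Rightarrow> (bracketing \<times> bracketing) set" where
  "assoc_rel f n = {(s, t). s \<in> bracketings n \<and> t \<in> bracketings n \<and>
     satisfies_identity f (eps1 s) (eps1 t)}"

definition assoc_spectrum :: "('a \<Rightarrow> 'a \<Rightarrow> 'a) \<Rightarrow> nat \<Rightarrow> nat" where
  "assoc_spectrum f n = card (bracketings n // assoc_rel f n)"

text \<open>Type \<^typ>\<open>6\<close> is the ring of integers modulo 6.\<close>

definition Y :: "6 poly" where
  "Y = [:0, 1:]"

definition G_op :: "6 poly \<Rightarrow> 6 poly \<Rightarrow> 6 poly" where
  "G_op X1 X2 = 3 * Y * X1 + 2 * Y * X2"

text \<open>\<^term>\<open>ring_power a k\<close> is $a^{k+1}$: class \<^class>\<open>ring\<close> does not require a unit, so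
  the library's power operation is not available and only positive powers make sense.\<close>

primrec ring_power :: "'r::ring \<Rightarrow> nat \<Rightarrow> 'r" where
  "ring_power a 0 = a"
| "ring_power a (Suc k) = a * ring_power a k"

text \<open>Both products are required to vanish because the ring need not be commutative. Some power
  of \<^term>\<open>a\<close> equalling one of \<^term>\<open>b\<close> need not be excluded: multiplying such an equation by
  \<^term>\<open>a\<close> gives a vanishing power of \<^term>\<open>a\<close>, so that higher powers coincide.\<close>

definition zero_divisors_distinct_powers :: "'r::ring \<Rightarrow> 'r \<Rightarrow> bool" where
  "zero_divisors_distinct_powers a b \<longleftrightarrow>
     a * b = 0 \<and> b * a = 0 \<and> inj (ring_power a) \<and> inj (ring_power b)"

end

(* Since ab = ba = 0, only the all-a path (to the first leaf) and the all-b path (to the last leaf)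
   contribute to the value of a bracketing. Hence the term operation is determined by the depths of
   these two leaves, and the hypothesis on the powers makes the depths recoverable from it. The
   depths, decreased by 1, of the bracketings with n >= 2 operation symbols are precisely the pairs
   (i, j) \<noteq> (0, 0) with i + j < n. *)

theory Submission
  imports Defs
begin

section \<open>Depths of the first and the last leaf, and the pairs that occur\<close>

primrec left_depth :: "'v trm \<Rightarrow> nat" where
  "left_depth (Var v) = 0"
| "left_depth (Omega s t) = Suc (left_depth s)"

primrec right_depth :: "'v trm \<Rightarrow> nat" where
  "right_depth (Var v) = 0"
| "right_depth (Omega s t) = Suc (right_depth t)"

lemma left_depth_le_num_omega: "left_depth t \<le> num_omega t"
  by (induction t) auto

lemma right_depth_le_num_omega: "right_depth t \<le> num_omega t"
  by (induction t) auto

lemma left_depth_eq_0_iff: "left_depth t = 0 \<longleftrightarrow> num_omega t = 0"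
  by (cases t) auto

lemma right_depth_eq_0_iff: "right_depth t = 0 \<longleftrightarrow> num_omega t = 0"
  by (cases t) auto

lemma ex_bracketing: "\<exists>t :: bracketing. num_omega t = n"
proof (induction n)
  case 0
  show ?case by (rule exI[of _ "Var ()"]) simp
next
  case (Suc n)
  then obtain t :: bracketing where "num_omega t = n" by blast
  then show ?case by (intro exI[of _ "Omega t (Var ())"]) simp
qed

text \<open>Only a variable has depth 0, whence the second hypothesis. Each level down to depth 1
  spends one symbol on a node whose right child is a leaf; at depth 1 the right subterm takes all
  remaining symbols.\<close>

lemma ex_bracketing_left_depth:
  assumes "i \<le> n" "i = 0 \<longleftrightarrow> n = 0"
  shows "\<exists>t :: bracketing. num_omega t = n \<and> left_depth t = i"
  using assms
proof (induction i arbitrary: n)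
  case 0
  then show ?case by (intro exI[of _ "Var ()"]) simp
next
  case (Suc i)
  then obtain m where m: "n = Suc m" by (cases n) auto
  show ?case
  \<comment> \<open>For \<open>i = 0\<close> the induction hypothesis would demand
    \<open>m = 0\<close>.\<close>
  proof (cases "i = 0")
    case True
    obtain t :: bracketing where "num_omega t = m" using ex_bracketing by blast
    then show ?thesis using m True by (intro exI[of _ "Omega (Var ()) t"]) simp
  next
    case False
    then obtain t :: bracketing where "num_omega t = m" "left_depth t = i"
      using Suc.IH[of m] Suc.prems m by auto
    then show ?thesis using m by (intro exI[of _ "Omega t (Var ())"]) simp
  qed
qed

text \<open>Reversal exchanges the two depths, which carries the existence result over to the right
  depth.\<close>

primrec mirror :: "'v trm \<Rightarrow> 'v trm" where
  "mirror (Var v) = Var v"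
| "mirror (Omega s t) = Omega (mirror t) (mirror s)"

lemma num_omega_mirror: "num_omega (mirror t) = num_omega t"
  by (induction t) auto

lemma right_depth_mirror: "right_depth (mirror t) = left_depth t"
  by (induction t) auto

lemma ex_bracketing_right_depth:
  assumes "i \<le> n" "i = 0 \<longleftrightarrow> n = 0"
  shows "\<exists>t :: bracketing. num_omega t = n \<and> right_depth t = i"
  using ex_bracketing_left_depth[OF assms] num_omega_mirror right_depth_mirror by metis

text \<open>In \<open>Omega l r\<close> the subterms share \<open>n - 1\<close> symbols and bound
  one decreased depth each. The pair \<open>(0, 0)\<close> would make both of them variables,
  against \<open>n \<ge> 2\<close>.\<close>

lemma depths_image:
  assumes "n \<ge> 2"
  shows "(\<lambda>t. (left_depth t, right_depth t)) ` bracketings n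
    = map_prod Suc Suc ` ((SIGMA i:{..<n}. {..<n - i}) - {(0, 0)})"
    (is "?f ` _ = map_prod Suc Suc ` ?D")
proof (intro equalityI subsetI)
  fix p assume "p \<in> ?f ` bracketings n"
  then obtain t where t: "num_omega t = n" "p = ?f t"
    by (auto simp: bracketings_def)
  with assms obtain l r where lr: "t = Omega l r" by (cases t) auto
  have "(left_depth l, right_depth r) \<in> ?D"
    using t(1) lr assms left_depth_le_num_omega[of l] right_depth_le_num_omega[of r]
      left_depth_eq_0_iff[of l] right_depth_eq_0_iff[of r]
    by auto
  then show "p \<in> map_prod Suc Suc ` ?D"
    using t(2) lr by force
next
  fix p assume "p \<in> map_prod Suc Suc ` ?D"
  then obtain q where q: "p = map_prod Suc Suc q" "q \<in> ?D" by (rule imageE)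
  obtain i j where "q = (i, j)" by (cases q)
  with q have ij: "i + j < n" "(i, j) \<noteq> (0, 0)" "p = (Suc i, Suc j)"
    by auto
  \<comment> \<open>If \<open>j = 0\<close> then the right subterm is a variable, so the left one has to be as large as
    possible; otherwise the minimal left subterm works.\<close>
  define k where "k = (if j = 0 then n - 1 else i)"
  have "i \<le> k" "i = 0 \<longleftrightarrow> k = 0" "j \<le> n - 1 - k" "j = 0 \<longleftrightarrow> n - 1 - k = 0"
    using ij assms by (auto simp: k_def)
  then obtain l r :: bracketing where l: "num_omega l = k" "left_depth l = i"
    and r: "num_omega r = n - 1 - k" "right_depth r = j"
    by (metis ex_bracketing_left_depth ex_bracketing_right_depth)
  have "Omega l r \<in> bracketings n"
    using l r ij by (auto simp: bracketings_def k_def)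
  then show "p \<in> ?f ` bracketings n"
    using l r ij by (intro image_eqI[of _ _ "Omega l r"]) simp_all
qed

lemma card_depths:
  assumes "n \<ge> 2"
  shows "real (card ((\<lambda>t. (left_depth t, right_depth t)) ` bracketings n))
    = ((real n)\<^sup>2 + real n - 2) / 2"
proof -
  let ?S = "SIGMA i:{..<n}. {..<n - i}"
  have "card ?S = (\<Sum>i<n. n - i)" by simp
  \<comment> \<open>Summation in reverse order gives the triangular number.\<close>
  also have "\<dots> = (\<Sum>i<n. Suc i)"
    by (subst sum.nat_diff_reindex[symmetric]) (auto intro!: sum.cong)
  finally have S: "card ?S = (\<Sum>i<n. Suc i)" .
  have sum: "real (\<Sum>i<n. Suc i) = ((real n)\<^sup>2 + real n) / 2" for n
    by (induction n) (auto simp: field_simps power2_eq_square)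
  have "card (map_prod Suc Suc ` (?S - {(0, 0)})) = card (?S - {(0, 0)})"
    by (intro card_image inj_onI) auto
  also have "\<dots> = card ?S - 1"
    using assms by (subst card_Diff_singleton) auto
  finally have "card (map_prod Suc Suc ` (?S - {(0, 0)})) = card ?S - 1" .
  \<comment> \<open>Guards the truncated subtraction \<open>card ?S - 1\<close> on the way to the
    reals.\<close>
  moreover have "card ?S \<ge> 1"
    unfolding S using assms by (cases n) auto
  ultimately show ?thesis
    unfolding depths_image[OF assms] using S sum[of n]
    by (simp add: field_simps del: card_SigmaI)
qed

text \<open>The classes of a kernel are the nonempty fibres, and a fibre determines its
  value.\<close>

lemma card_quotient_kernel:
  "card (A // {(x, y). x \<in> A \<and> y \<in> A \<and> f x = f y}) = card (f ` A)"
proof -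
  let ?C = "\<lambda>z. {y \<in> A. f y = z}"
  have "A // {(x, y). x \<in> A \<and> y \<in> A \<and> f x = f y} = ?C ` f ` A"
    by (simp add: quotient_def Image_def image_image UNION_singleton_eq_range eq_commute
        cong: conj_cong)
  moreover have "inj_on ?C (f ` A)"
    by (rule inj_onI) blast
  ultimately show ?thesis by (simp add: card_image)
qed

section \<open>Term operations of a x + b y\<close>

context
  fixes a b :: "'r::ring"
  assumes ab: "zero_divisors_distinct_powers a b"
begin

lemma mult_absorb:
  "a * (a * x + b * y) = a * (a * x)" "b * (a * x + b * y) = b * (b * y)"
  using ab by (simp_all add: zero_divisors_distinct_powers_def distrib_left flip: mult.assoc)

text \<open>The leading factor \<open>a\<close> makes the induction work: it kills the right summand
  at the root, and the left summand brings a new \<open>a\<close> for the left subterm. Iteration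
  replaces powers since depth 0 must give the identity even without a unit.\<close>

lemma mult_eval_left:
  "a * eval_trm (\<lambda>x y. a * x + b * y) \<rho> (number_from k t) = a * ((*) a ^^ left_depth t) (\<rho> k)"
  by (induction t arbitrary: k) (simp_all add: mult_absorb)

lemma mult_eval_right:
  "b * eval_trm (\<lambda>x y. a * x + b * y) \<rho> (number_from k t)
    = b * ((*) b ^^ right_depth t) (\<rho> (k + num_omega t))"
  by (induction t arbitrary: k) (simp_all add: mult_absorb add.assoc)

text \<open>The root supplies the factors \<open>a\<close> and \<open>b\<close> for the two
  subterms. For a single variable both leaves coincide and the sum would count it twice.\<close>

lemma eval_eps1:
  assumes "num_omega t > 0"
  shows "eval_trm (\<lambda>x y. a * x + b * y) \<rho> (eps1 t)
    = ((*) a ^^ left_depth t) (\<rho> 1) + ((*) b ^^ right_depth t) (\<rho> (Suc (num_omega t)))"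
  using assms by (cases t) (auto simp: eps1_def mult_eval_left mult_eval_right)

lemma ring_power_funpow: "ring_power c k = ((*) c ^^ k) c" for c :: 'r
  by (induction k) auto

lemma funpow_mult_zero: "((*) c ^^ k) 0 = 0" for c :: 'r
  by (induction k) auto

lemma satisfies_identity_iff:
  assumes "num_omega s = n" "num_omega t = n" "n > 0"
  shows "satisfies_identity (\<lambda>x y. a * x + b * y) (eps1 s) (eps1 t)
    \<longleftrightarrow> left_depth s = left_depth t \<and> right_depth s = right_depth t"
proof
  assume *: "satisfies_identity (\<lambda>x y. a * x + b * y) (eps1 s) (eps1 t)"
  have eq: "((*) a ^^ left_depth s) (\<rho> 1) + ((*) b ^^ right_depth s) (\<rho> (Suc n))
      = ((*) a ^^ left_depth t) (\<rho> 1) + ((*) b ^^ right_depth t) (\<rho> (Suc n))" for \<rho>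
    using * assms eval_eps1[of s \<rho>] eval_eps1[of t \<rho>]
    by (simp add: satisfies_identity_def)
  \<comment> \<open>Putting \<open>a\<close> at the first leaf and 0 elsewhere isolates the power of
    exponent depth + 1, which \<open>ring_power\<close> indexes by the depth; \<open>n > 0\<close>
    keeps the two leaves distinct.\<close>
  have "ring_power a (left_depth s) = ring_power a (left_depth t)"
    using eq[of "(\<lambda>_. 0)(1 := a)"] assms(3) by (simp add: ring_power_funpow funpow_mult_zero)
  moreover have "ring_power b (right_depth s) = ring_power b (right_depth t)"
    using eq[of "(\<lambda>_. 0)(Suc n := b)"] assms(3) by (simp add: ring_power_funpow funpow_mult_zero)
  ultimately show "left_depth s = left_depth t \<and> right_depth s = right_depth t"
    using ab by (simp add: zero_divisors_distinct_powers_def inj_eq)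
next
  assume "left_depth s = left_depth t \<and> right_depth s = right_depth t"
  then show "satisfies_identity (\<lambda>x y. a * x + b * y) (eps1 s) (eps1 t)"
    using assms by (simp add: satisfies_identity_def eval_eps1)
qed

lemma assoc_spectrum_linear:
  assumes "n \<ge> 2"
  shows "real (assoc_spectrum (\<lambda>x y. a * x + b * y) n) = ((real n)\<^sup>2 + real n - 2) / 2"
proof -
  \<comment> \<open>The relation is the kernel of the pair of depths, so its classes are counted by
    the pairs.\<close>
  have "assoc_rel (\<lambda>x y. a * x + b * y) n
      = {(s, t). s \<in> bracketings n \<and> t \<in> bracketings n \<and>
          (left_depth s, right_depth s) = (left_depth t, right_depth t)}"
    using assms by (auto simp: assoc_rel_def bracketings_def satisfies_identity_iff)
  then show ?thesis
    unfolding assoc_spectrum_def using card_depths[OF assms] by (simp only: card_quotient_kernel)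
qed

end

section \<open>Powers of 3Y and 2Y\<close>

lemma ring_power_monom: "ring_power (monom c 1) k = monom (c ^ Suc k) (Suc k)"
  for c :: "'a::comm_ring_1"
  by (induction k) (simp_all add: mult_monom)

text \<open>Nonzero coefficients let the degree tell the powers apart.\<close>

lemma inj_ring_power_monom:
  fixes c :: "'a::comm_ring_1"
  assumes "\<And>k. c ^ Suc k \<noteq> 0"
  shows "inj (ring_power (monom c 1))"
proof (rule injI)
  fix k m assume "ring_power (monom c 1) k = ring_power (monom c 1) m"
  then have "degree (monom (c ^ Suc k) (Suc k)) = degree (monom (c ^ Suc m) (Suc m))"
    by (simp only: ring_power_monom)
  then show "k = m" by (simp only: degree_monom_eq[OF assms] nat.inject)
qed

lemma numeral_mult_Y: "numeral w * Y = monom (numeral w) 1"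
  by (simp add: Y_def monom_altdef numeral_poly)

lemma zero_divisors_distinct_powers_Y: "zero_divisors_distinct_powers (3 * Y) (2 * Y)"
proof -
  \<comment> \<open>Modulo 6, 3 is idempotent and the powers of 2 stay in {2, 4}, so neither is
    nilpotent.\<close>
  have "(3::6) ^ Suc k = 3" for k
    by (induction k) simp_all
  moreover have "(2::6) ^ Suc k = 2 \<or> (2::6) ^ Suc k = 4" for k
  proof (induction k)
    case (Suc k)
    then show ?case by (subst (1 2) power_Suc) (elim disjE; simp only:; simp)
  qed simp
  moreover have "(2::6) \<noteq> 0" "(3::6) \<noteq> 0" "(4::6) \<noteq> 0"
    by simp_all
  ultimately have "(3::6) ^ Suc k \<noteq> 0" "(2::6) ^ Suc k \<noteq> 0" for k
    by metis+
  then have "inj (ring_power (monom (3::6) 1))" "inj (ring_power (monom (2::6) 1))"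
    by (simp_all only: inj_ring_power_monom not_False_eq_True)
  \<comment> \<open>Both products have coefficient 6 = 0.\<close>
  then show ?thesis
    by (simp add: zero_divisors_distinct_powers_def numeral_mult_Y mult_monom)
qed

theorem mainTheorem8:
  shows "(\<forall>n\<ge>2. real (assoc_spectrum G_op n) = ((real n)\<^sup>2 + real n - 2) / 2)
    \<and> zero_divisors_distinct_powers (3 * Y) (2 * Y)
    \<and> (\<forall>a b :: 'r::ring. zero_divisors_distinct_powers a b \<longrightarrow>
         (\<forall>n\<ge>2. real (assoc_spectrum (\<lambda>x y. a * x + b * y) n)
                  = ((real n)\<^sup>2 + real n - 2) / 2))"
proof -
  have "G_op = (\<lambda>x y. (3 * Y) * x + (2 * Y) * y)"
    by (intro ext) (simp add: G_op_def)
  then show ?thesis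
    using assoc_spectrum_linear[OF zero_divisors_distinct_powers_Y] assoc_spectrum_linear
      zero_divisors_distinct_powers_Y
    by auto
qed

end
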